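(* Let $A\in\mathbb{R}^{m\times n}$ ($m,n\ge 1$) have no zero rows, let $r=\mathrm{rank}(A)$, and let $b\in\mathrm{range}(A)$. Let $A=U\Sigma V^\top$ be a compact singular value decomposition and let $\hat A$, $L$, $M$ be the matrices associated with $A$ as defined in the context. Let $(x_k)_{k\ge0}$ be the full-cycle iterates of the cyclic Kaczmarz method for $Ax=b$ started at an arbitrary $x_0\in\mathbb{R}^n$, let $x^*$ be the solution of $Ax=b$ closest to $x_0$, and let $e_k:=V^\top(x_k-x^* )\in\mathbb{R}^r$. Then for every $k\ge0$, $$e_{k+1}=\big(I_r-(\hat AV)^\top L^{-1}\hat AV\big)e_k=Me_k .$$ Furthermore, for every $k\ge 0$, $$\|e_{k+1}\|^2=\|e_k\|^2-\|L^{-1}\hat AVe_k\|^2\le\|e_k\|^2,$$ and, as a result, $\|M\|_{\mathrm{op}}<1$.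
   Context: $\|\cdot\|$ is the Euclidean norm on vectors and $\|\cdot\|_{\mathrm{op}}$ the induced operator (spectral) norm on matrices; $I_p$ is the $p\times p$ identity. The rows of $A$ are $a_1,\dots,a_m\in\mathbb{R}^n$ (viewed as column vectors in inner products), $\hat a_i=a_i/\|a_i\|$, and $\hat A\in\mathbb{R}^{m\times n}$ is the matrix with rows $\hat a_i$. Compact SVD: $A=U\Sigma V^\top$ with $U\in\mathbb{R}^{m\times r}$, $V\in\mathbb{R}^{n\times r}$, $U^\top U=V^\top V=I_r$, $\Sigma=\mathrm{diag}(\sigma_1,\dots,\sigma_r)$, $\sigma_1\ge\dots\ge\sigma_r>0$. $L\in\mathbb{R}^{m\times m}$ is the unit lower triangular matrix with $L_{ij}=\langle\hat a_i,\hat a_j\rangle$ for $j<i$, $L_{ii}=1$, $L_{ij}=0$ for $j>i$. $M:=I_r-(\hat AV)^\top L^{-1}\hat AV\in\mathbb{R}^{r\times r}$. Cyclic Kaczmarz method: $x_{0,0}=x_0$; for each $k\ge0$ and $i=1,\dots,m$ in this order, $x_{k,i}=x_{k,i-1}-\frac{\langle a_i,x_{k,i-1}\rangle-b^{(i)}}{\|a_i\|^2}a_i$, where $b^{(i)}$ is the $i$-th entry of $b$; then $x_{k+1}=x_{k+1,0}=x_{k,m}$ (and $x_{k,0}=x_k$). $x^*=\mathrm{argmin}_{x:\,Ax=b}\|x_0-x\|=x_0-A^\dagger(Ax_0-b)$, where $A^\dagger$ is the Moore–Penrose pseudoinverse. *)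

theory Defs
  imports "HOL-Analysis.Analysis"
begin

text \<open>
  An \<open>m \<times> n\<close> matrix is an element of \<^typ>\<open>real^'n^'m\<close>. Where the order of the indices
  \<open>1, \<dots>, m\<close> or \<open>1, \<dots>, r\<close> matters (triangularity, cyclic sweeps, ordering of singular values),
  the index type is a finite linear order, whose \<open>i\<close>-th smallest element plays
  the role of the index \<open>i\<close>.
\<close>

definition diag_matrix :: "real^'r \<Rightarrow> real^'r^'r" where
  "diag_matrix s = (\<chi> i j. if i = j then s $ i else 0)"

definition compact_svd ::
    "real^'n^'m \<Rightarrow> real^('r::{finite,linorder})^'m \<Rightarrow> real^('r::{finite,linorder}) \<Rightarrow>
     real^('r::{finite,linorder})^'n \<Rightarrow> bool" where
  "compact_svd A U s V \<longleftrightarrow>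
     A = U ** diag_matrix s ** transpose V \<and>
     transpose U ** U = mat 1 \<and> transpose V ** V = mat 1 \<and>
     (\<forall>i j. i \<le> j \<longrightarrow> s $ j \<le> s $ i) \<and> (\<forall>i. 0 < s $ i)"

definition normalize_rows :: "real^'n^'m \<Rightarrow> real^'n^'m" where
  "normalize_rows A = (\<chi> i. (1 / norm (row i A)) *\<^sub>R row i A)"

definition gram_lower ::
    "real^'n^('m::{finite,linorder}) \<Rightarrow>
     real^('m::{finite,linorder})^('m::{finite,linorder})" where
  "gram_lower A = (\<chi> i j.
     if j < i then row i (normalize_rows A) \<bullet> row j (normalize_rows A)
     else if j = i then 1 else 0)"

definition error_matrix ::
    "real^'n^('m::{finite,linorder}) \<Rightarrow> real^'r^'n \<Rightarrow> real^'r^'r" where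
  "error_matrix A V =
     mat 1 - transpose (normalize_rows A ** V) ** matrix_inv (gram_lower A) ** (normalize_rows A ** V)"

definition kaczmarz_step :: "real^'n^'m \<Rightarrow> real^'m \<Rightarrow> 'm \<Rightarrow> real^'n \<Rightarrow> real^'n" where
  "kaczmarz_step A b i x = x - ((row i A \<bullet> x - b $ i) / (norm (row i A))\<^sup>2) *\<^sub>R row i A"

text \<open>One full cycle: \<^const>\<open>fold\<close> applies the step for the smallest row index first.\<close>

definition kaczmarz_cycle ::
    "real^'n^('m::{finite,linorder}) \<Rightarrow> real^('m::{finite,linorder}) \<Rightarrow>
     real^'n \<Rightarrow> real^'n" where
  "kaczmarz_cycle A b = fold (kaczmarz_step A b) (sorted_list_of_set UNIV)"

primrec kaczmarz ::
    "real^'n^('m::{finite,linorder}) \<Rightarrow> real^('m::{finite,linorder}) \<Rightarrow>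
     real^'n \<Rightarrow> nat \<Rightarrow> real^'n" where
  "kaczmarz A b x0 0 = x0"
| "kaczmarz A b x0 (Suc k) = kaczmarz_cycle A b (kaczmarz A b x0 k)"

text \<open>
  For \<open>b\<close> in the range of \<open>A\<close> the minimizer exists and is unique; for other \<open>b\<close> the value is
  unspecified.
\<close>

definition nearest_solution :: "real^'n^'m \<Rightarrow> real^'m \<Rightarrow> real^'n \<Rightarrow> real^'n" where
  "nearest_solution A b x0 = arg_min (\<lambda>x. norm (x0 - x)) (\<lambda>x. A *v x = b)"

definition kaczmarz_error ::
    "real^'n^('m::{finite,linorder}) \<Rightarrow> real^('m::{finite,linorder}) \<Rightarrow>
     real^'n \<Rightarrow> real^'r^'n \<Rightarrow> nat \<Rightarrow> real^'r" where
  "kaczmarz_error A b x0 V k =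
     transpose V *v (kaczmarz A b x0 k - nearest_solution A b x0)"

end

theory Submission
  imports Defs
begin

text \<open>
  The argument rests on the identity \<open>L + L\<^sup>T = \<hat>A \<hat>A\<^sup>T + I\<close>. It gives
  \<open>2 \<langle>y, L y\<rangle> = \<parallel>\<hat>A\<^sup>T y\<parallel>\<^sup>2 + \<parallel>y\<parallel>\<^sup>2\<close>, hence invertibility of \<open>L\<close>, and, whenever
  \<open>L y = \<hat>A z\<close>, the identity \<open>\<parallel>z - \<hat>A\<^sup>T y\<parallel>\<^sup>2 = \<parallel>z\<parallel>\<^sup>2 - \<parallel>y\<parallel>\<^sup>2\<close>. One cycle maps the error
  \<open>z\<close> to \<open>z - \<hat>A\<^sup>T y\<close> for exactly this \<open>y\<close>: forward substitution in \<open>L y = \<hat>A z\<close>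
  computes the step lengths of the successive projections. Since the rows of \<open>\<hat>A\<close> lie in the range
  of \<open>V\<close>, all this remains true with \<open>\<hat>A V\<close> in place of \<open>\<hat>A\<close>, and \<open>\<hat>A V\<close> is injective,
  so \<open>M\<close> strictly decreases norms of nonzero vectors; compactness of the sphere finishes the proof.
\<close>

text \<open>Pointwise strictness alone bounds the operator norm only by 1; in finite dimension it is
  attained at a unit vector \<open>u\<close>, and strictness at \<open>u\<close> closes the
  gap.\<close>

lemma onorm_less_1_if_strict_contraction:
  fixes f :: "'a::euclidean_space \<Rightarrow> 'b::real_normed_vector"
  assumes lin: "bounded_linear f" and less: "\<And>x. x \<noteq> 0 \<Longrightarrow> norm (f x) < norm x"
  shows "onorm f < 1"
proof -
  interpret bounded_linear f by (rule lin)
  have "continuous_on (sphere 0 1) (\<lambda>x. norm (f x))"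
    by (intro continuous_intros continuous_on)
  moreover have "sphere (0::'a) 1 \<noteq> {}"
    by simp
  ultimately obtain u where u: "u \<in> sphere 0 1"
    and max: "\<And>x. x \<in> sphere 0 1 \<Longrightarrow> norm (f x) \<le> norm (f u)"
    using continuous_attains_sup[OF compact_sphere] by metis
  have "onorm f \<le> norm (f u)"
  proof (rule onorm_le)
    fix x
    show "norm (f x) \<le> norm (f u) * norm x"
    proof (cases "x = 0")
      case False
      then have "norm (f (x /\<^sub>R norm x)) \<le> norm (f u)"
        by (intro max) simp
      then show ?thesis
        using False by (simp add: scaleR field_simps)
    qed (simp add: zero)
  qed
  also have "norm (f u) < 1"
    using less[of u] u by force
  finally show ?thesis .
qed

lemma inner_matrix_symmetric_part:
  fixes L :: "real^'m^'m" and B :: "real^'n^'m"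
  assumes "L + transpose L = B ** transpose B + mat 1"
  shows "2 * (y \<bullet> (L *v y)) = (norm (transpose B *v y))\<^sup>2 + (norm y)\<^sup>2"
proof -
  have "2 * (y \<bullet> (L *v y)) = y \<bullet> ((L + transpose L) *v y)"
    by (simp add: matrix_vector_mult_add_rdistrib inner_add_right dot_lmul_matrix[symmetric]
        inner_commute)
  also have "\<dots> = (norm (transpose B *v y))\<^sup>2 + (norm y)\<^sup>2"
    by (simp add: assms matrix_vector_mult_add_rdistrib inner_add_right dot_lmul_matrix[symmetric]
        matrix_vector_mul_assoc[symmetric] power2_norm_eq_inner)
  finally show ?thesis .
qed

lemma invertible_if_symmetric_part:
  fixes L :: "real^'m^'m" and B :: "real^'n^'m"
  assumes "L + transpose L = B ** transpose B + mat 1"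
  shows "invertible L"
proof -
  have "y = 0" if "L *v y = 0" for y
    using inner_matrix_symmetric_part[OF assms, of y] that
    by (simp add: add_nonneg_eq_0_iff)
  then show ?thesis
    by (simp add: invertible_left_inverse matrix_left_invertible_ker)
qed

text \<open>When the square is expanded, twice the cross term is
  \<open>2 * (y \<bullet> (L *v y))\<close>; it cancels the square of
  \<open>norm (transpose B *v y)\<close>.\<close>

lemma norm_diff_transpose_mult:
  fixes L :: "real^'m^'m" and B :: "real^'n^'m"
  assumes "L + transpose L = B ** transpose B + mat 1" and "L *v y = B *v z"
  shows "(norm (z - transpose B *v y))\<^sup>2 = (norm z)\<^sup>2 - (norm y)\<^sup>2"
proof -
  have "z \<bullet> (transpose B *v y) = y \<bullet> (L *v y)"
    by (simp add: assms(2) dot_lmul_matrix[symmetric] inner_commute)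
  then show ?thesis
    using inner_matrix_symmetric_part[OF assms(1), of y]
    by (simp add: power2_norm_eq_inner inner_diff_left inner_diff_right inner_commute)
qed

lemma normalize_rows_mult_vec:
  "(normalize_rows A *v x) $ i = (A *v x) $ i / norm (row i A)"
  by (simp add: normalize_rows_def matrix_vector_mult_def row_def sum_divide_distrib)

lemma row_normalize_rows: "row i (normalize_rows A) = row i A /\<^sub>R norm (row i A)"
  by (simp add: normalize_rows_def row_def vec_eq_iff divide_inverse)

lemma mult_transpose_nth:
  fixes B :: "real^'n^'m"
  shows "(B ** transpose B) $ i $ j = row i B \<bullet> row j B"
  by (simp add: matrix_matrix_mult_def transpose_def row_def inner_vec_def)

text \<open>Nonzero rows become unit rows, so the Gram matrix has diagonal 1 and
  \<open>mat 1\<close> makes up for the doubled diagonal on the left.\<close>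

lemma gram_lower_plus_transpose:
  fixes A :: "real^'n^('m::{finite,linorder})"
  assumes "\<forall>i. row i A \<noteq> 0"
  shows "gram_lower A + transpose (gram_lower A) =
    normalize_rows A ** transpose (normalize_rows A) + mat 1"
proof -
  have "row i (normalize_rows A) \<bullet> row i (normalize_rows A) = 1" for i
    using assms by (simp add: row_normalize_rows flip: power2_norm_eq_inner)
  moreover have "transpose (gram_lower A) $ i $ j = gram_lower A $ j $ i" for i j
    by (simp add: transpose_def)
  ultimately show ?thesis
    unfolding vec_eq_iff
    by (auto simp: mult_transpose_nth gram_lower_def mat_def inner_commute)
qed

lemma gram_lower_mult_vec:
  fixes A :: "real^'n^('m::{finite,linorder})"
  shows "(gram_lower A *v y) $ i =
    y $ i + row i (normalize_rows A) \<bullet> (\<Sum>j | j < i. y $ j *\<^sub>R row j (normalize_rows A))"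
proof -
  have "(gram_lower A *v y) $ i = (\<Sum>j\<in>UNIV. (if j = i then y $ j else 0) +
      (if j < i then (row i (normalize_rows A) \<bullet> row j (normalize_rows A)) * y $ j else 0))"
    by (auto simp: gram_lower_def matrix_vector_mult_def intro!: sum.cong)
  then show ?thesis
    by (simp add: sum.distrib inner_sum_right mult.commute flip: sum.inter_filter)
qed

text \<open>Since \<open>w\<close> solves the system, the residual depends on the error alone, and
  the step projects the error onto the orthogonal complement of row \<open>i\<close>.\<close>

lemma kaczmarz_step_error:
  assumes "A *v w = b"
  shows "kaczmarz_step A b i x - w =
    (x - w) - (row i (normalize_rows A) \<bullet> (x - w)) *\<^sub>R row i (normalize_rows A)"
proof -
  have "b $ i = row i A \<bullet> w"
    using assms by (auto simp: matrix_vector_mul_component row_def)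
  then show ?thesis
    by (simp add: kaczmarz_step_def row_normalize_rows inner_diff_right power2_eq_square
        divide_inverse algebra_simps)
qed

lemma kaczmarz_cycle_error:
  fixes A :: "real^'n^('m::{finite,linorder})"
  assumes w: "A *v w = b" and y: "gram_lower A *v y = normalize_rows A *v (x - w)"
  shows "kaczmarz_cycle A b x - w = (x - w) - transpose (normalize_rows A) *v y"
proof -
  let ?a = "\<lambda>i. row i (normalize_rows A)"
  have prefix: "fold (kaczmarz_step A b) xs x - w = (x - w) - (\<Sum>j\<in>set xs. y $ j *\<^sub>R ?a j)"
    if "xs @ ys = sorted_list_of_set UNIV" for xs ys
    using that
  proof (induction xs arbitrary: ys rule: rev_induct)
    case (snoc i xs)
    have eq: "xs @ i # ys = sorted_list_of_set UNIV"
      using snoc.prems by simp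
    have "sorted (xs @ i # ys)" "distinct (xs @ i # ys)" "set (xs @ i # ys) = UNIV"
      unfolding eq by simp_all
    \<comment> \<open>Sortedness makes the rows already visited exactly those below
      \<open>i\<close>, the index set in row \<open>i\<close> of
      \<open>gram_lower A\<close>.\<close>
    then have below: "set xs = {j. j < i}" and "i \<notin> set xs"
      by (auto simp: sorted_append order.strict_iff_order)
        (metis UNIV_I Un_iff insert_iff leD order_le_less)+
    have "?a i \<bullet> (x - w) = (gram_lower A *v y) $ i"
      by (simp add: y matrix_vector_mul_component row_def)
    \<comment> \<open>Row \<open>i\<close> of the triangular system: \<open>y $ i\<close> is the
      coefficient of \<open>?a i\<close> in the next projection.\<close>
    then have y_i: "y $ i = ?a i \<bullet> ((x - w) - (\<Sum>j\<in>set xs. y $ j *\<^sub>R ?a j))"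
      by (simp add: gram_lower_mult_vec below inner_diff_right)
    then have "fold (kaczmarz_step A b) (xs @ [i]) x - w =
        (x - w) - (\<Sum>j\<in>set xs. y $ j *\<^sub>R ?a j) - y $ i *\<^sub>R ?a i"
      by (simp add: kaczmarz_step_error[OF w] snoc.IH[OF eq])
    then show ?case
      using \<open>i \<notin> set xs\<close> by simp
  qed simp
  have "transpose (normalize_rows A) *v y = (\<Sum>j\<in>UNIV. y $ j *\<^sub>R ?a j)"
    by (simp add: matrix_mult_sum scalar_mult_eq_scaleR column_transpose)
  then show ?thesis
    using prefix[of "sorted_list_of_set UNIV" "[]"] by (simp add: kaczmarz_cycle_def)
qed

text \<open>\<open>arg_min\<close> is a choice operator, so a minimizer has to exist first; a
  nonempty closed set contains a point nearest to \<open>x0\<close>.\<close>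

lemma nearest_solution_solves:
  assumes "b \<in> range (\<lambda>x. A *v x)"
  shows "A *v nearest_solution A b x0 = b"
proof -
  let ?S = "{x. A *v x = b}"
  have "closed ?S"
    by (intro closed_Collect_eq continuous_intros matrix_vector_mult_linear_continuous_on)
  moreover have "?S \<noteq> {}"
    using assms by auto
  ultimately obtain x where "A *v x = b" "\<forall>z. A *v z = b \<longrightarrow> dist x0 x \<le> dist x0 z"
    using distance_attains_inf[of ?S x0] by auto
  then have "is_arg_min (\<lambda>x. norm (x0 - x)) (\<lambda>x. A *v x = b) x"
    by (auto simp: is_arg_min_linorder dist_norm)
  then show ?thesis
    unfolding nearest_solution_def arg_min_def is_arg_min_def
    by (rule someI2) simp
qed

text \<open>\<open>V ** transpose V\<close> is the orthogonal projection onto the row space; the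
  factor \<open>transpose V\<close> of \<open>A\<close> absorbs it.\<close>

lemma compact_svd_mult_projection:
  assumes "compact_svd A U s V"
  shows "A *v (V *v (transpose V *v x)) = A *v x"
proof -
  have "transpose V ** V ** transpose V = transpose V"
    using assms by (simp add: compact_svd_def)
  then have "A ** V ** transpose V = A"
    using assms by (metis compact_svd_def matrix_mul_assoc)
  then show ?thesis
    by (simp add: matrix_vector_mul_assoc matrix_mul_assoc del: transpose_matrix_vector)
qed

text \<open>Multiplying by \<open>transpose U\<close> reduces \<open>A ** V\<close> to a diagonal
  matrix with positive entries.\<close>

lemma compact_svd_mult_right_inj:
  assumes svd: "compact_svd A U s V" and "A *v (V *v v) = 0"
  shows "v = 0"
proof -
  have "transpose U ** (A ** V) = diag_matrix s"
    using svd unfolding compact_svd_def by (metis matrix_mul_assoc matrix_mul_lid matrix_mul_rid)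
  then have "diag_matrix s *v v = 0"
    using assms(2) by (metis matrix_vector_mul_assoc matrix_vector_mult_0_right)
  then have "s $ i * v $ i = 0" for i
    by (simp add: vec_eq_iff diag_matrix_def matrix_vector_mult_def
        if_distrib[of "\<lambda>c. c * _"] cong: if_cong)
  moreover have "s $ i \<noteq> 0" for i
    using svd by (metis compact_svd_def less_irrefl)
  ultimately show ?thesis
    by (simp add: vec_eq_iff)
qed

theorem lemma1:
  fixes A :: "real^'n^('m::{finite,linorder})"
    and U :: "real^('r::{finite,linorder})^('m::{finite,linorder})"
    and s :: "real^('r::{finite,linorder})"
    and V :: "real^('r::{finite,linorder})^'n"
    and b :: "real^('m::{finite,linorder})"
    and x0 :: "real^'n"
  assumes nonzero_rows: "\<forall>i. row i A \<noteq> 0"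
    and r: "CARD('r) = rank A"
    and b: "b \<in> range (\<lambda>x. A *v x)"
    and svd: "compact_svd A U s V"
  shows "let e = kaczmarz_error A b x0 V;
             Ah = normalize_rows A;
             L = gram_lower A;
             M = error_matrix A V
         in (\<forall>k. e (Suc k) = (mat 1 - transpose (Ah ** V) ** matrix_inv L ** (Ah ** V)) *v e k
                 \<and> e (Suc k) = M *v e k)
          \<and> (\<forall>k. (norm (e (Suc k)))\<^sup>2 = (norm (e k))\<^sup>2 - (norm (matrix_inv L *v ((Ah ** V) *v e k)))\<^sup>2
                 \<and> (norm (e (Suc k)))\<^sup>2 \<le> (norm (e k))\<^sup>2)
          \<and> onorm (\<lambda>x. M *v x) < 1"
proof -
  define e where "e = kaczmarz_error A b x0 V"
  define Ah where "Ah = normalize_rows A"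
  define L where "L = gram_lower A"
  define M where "M = error_matrix A V"
  define B where "B = Ah ** V"
  define w where "w = nearest_solution A b x0"
  have M_eq: "M = mat 1 - transpose B ** matrix_inv L ** B"
    by (simp add: M_def error_matrix_def B_def Ah_def L_def)
  have Ah_proj: "Ah *v (V *v (transpose V *v x)) = Ah *v x" for x
    using compact_svd_mult_projection[OF svd, of x]
    by (simp add: vec_eq_iff Ah_def normalize_rows_mult_vec)
  then have "Ah ** V ** transpose V = Ah"
    by (simp add: matrix_eq matrix_vector_mul_assoc matrix_mul_assoc del: transpose_matrix_vector)
  \<comment> \<open>\<open>Ah\<close> absorbs the inner factor \<open>V ** transpose V\<close>, so
    the symmetric-part identity passes from \<open>Ah\<close> to \<open>B\<close>.\<close>
  then have "B ** transpose B = Ah ** transpose Ah"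
    by (metis B_def matrix_transpose_mul matrix_mul_assoc)
  then have sym: "L + transpose L = B ** transpose B + mat 1"
    using gram_lower_plus_transpose[OF nonzero_rows] by (simp add: L_def Ah_def)
  have L_inv: "L *v (matrix_inv L *v y) = y" for y
    using someI_ex[OF invertible_if_symmetric_part[OF sym, unfolded invertible_def]]
    by (simp add: matrix_inv_def matrix_vector_mul_assoc)
  have M_mult: "M *v v = v - transpose B *v (matrix_inv L *v (B *v v))" for v
    by (simp add: M_eq matrix_vector_mult_diff_rdistrib matrix_vector_mul_assoc
        matrix_mul_assoc)
  have M_norm: "(norm (M *v v))\<^sup>2 = (norm v)\<^sup>2 - (norm (matrix_inv L *v (B *v v)))\<^sup>2" for v
    unfolding M_mult by (rule norm_diff_transpose_mult[OF sym L_inv])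
  have rec: "e (Suc k) = M *v e k" for k
  proof -
    let ?x = "kaczmarz A b x0 k" and ?y = "matrix_inv L *v (B *v e k)"
    have e_eq: "e i = transpose V *v (kaczmarz A b x0 i - w)" for i
      by (simp add: e_def kaczmarz_error_def w_def)
    \<comment> \<open>\<open>e k\<close> keeps only the row-space part of the error, but
      \<open>Ah\<close> sees nothing else; so one vector \<open>?y\<close> serves both the cycle and
      \<open>M\<close>.\<close>
    have "B *v e k = Ah *v (?x - w)"
      unfolding e_eq B_def by (simp only: Ah_proj flip: matrix_vector_mul_assoc)
    then have "L *v ?y = Ah *v (?x - w)"
      by (simp only: L_inv)
    then have "kaczmarz A b x0 (Suc k) - w = (?x - w) - transpose Ah *v ?y"
      unfolding kaczmarz.simps L_def Ah_def w_def
      by (rule kaczmarz_cycle_error[OF nearest_solution_solves[OF b]])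
    then have "e (Suc k) = e k - transpose V *v (transpose Ah *v ?y)"
      unfolding e_eq by (simp only: matrix_vector_mult_diff_distrib)
    then show ?thesis
      by (simp only: M_mult B_def matrix_transpose_mul matrix_vector_mul_assoc
          matrix_mul_assoc)
  qed
  have "onorm ((*v) M) < 1"
  proof (rule onorm_less_1_if_strict_contraction)
    fix v :: "real^('r::{finite,linorder})"
    assume "v \<noteq> 0"
    \<comment> \<open>By \<open>M_norm\<close> the decrease is strict unless this vector vanishes;
      then \<open>B *v v = 0\<close>, and undoing the row scaling puts \<open>V *v v\<close> in the
      kernel of \<open>A\<close>.\<close>
    have "matrix_inv L *v (B *v v) \<noteq> 0"
    proof
      assume "matrix_inv L *v (B *v v) = 0"
      then have "Ah *v (V *v v) = 0"
        using L_inv[of "B *v v"] by (simp add: B_def matrix_vector_mul_assoc)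
      then have "A *v (V *v v) = 0"
        using nonzero_rows unfolding vec_eq_iff[of "_ *v _" 0]
        by (simp add: Ah_def normalize_rows_mult_vec)
      then show False
        using compact_svd_mult_right_inj[OF svd] \<open>v \<noteq> 0\<close> by blast
    qed
    then have "(norm (M *v v))\<^sup>2 < (norm v)\<^sup>2"
      by (simp add: M_norm)
    then show "norm (M *v v) < norm v"
      by (rule power2_less_imp_less) simp
  qed (rule matrix_vector_mul_bounded_linear)
  moreover have "(norm (M *v v))\<^sup>2 \<le> (norm v)\<^sup>2" for v
    by (simp only: M_norm) simp
  ultimately show ?thesis
    using rec M_norm
    by (simp add: Let_def M_eq flip: e_def Ah_def L_def M_def B_def)
qed

end
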